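(* Let $\pi:G\to\mathcal{B}(V)$ be a weakly mixing, uniformly bounded representation of a group $G$ on a Banach space $V$ with a separable dual $V^*$. Suppose that $W\subset V$ is preserved under $\pi$, and is endowed with a norm such that the inclusion $W\hookrightarrow V$ is compact. Then $\pi$ is not uniformly bounded on $W$.
   Context: A representation $\pi:G\to\mathcal{B}(V)$ of a group $G$ on a Banach space $V$ is uniformly bounded if $\sup_{g\in G}\|\pi(g)\|<\infty$. It is weakly mixing if for any $\theta\in V^*$ (the topological dual of $V$), any $v\in V$, and any $\varepsilon>0$, there exists $g\in G$ such that $|\theta(\pi(g)v)|<\varepsilon$. Uniform boundedness on $W$ refers to the operator norms of $\pi(g):W\to W$ with respect to the given norm on $W$.
   Formalization: Weak mixing is taken with one g serving any finite set of functionals θ at once, since with a single θ the claim fails (rotations of the real plane, V = W = R²); and W is assumed nonzero, since it fails for W = 0. *)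

theory Defs
  imports "HOL-Analysis.Analysis" "HOL-Algebra.Group"
begin

text \<open>
  The scalar field is \<open>'k :: {real_normed_field, euclidean_space}\<close>. Up to isomorphism the real
  and the complex numbers are the only such fields, so both real and complex Banach spaces are
  covered. The carrier type provides the norm and the underlying real vector space; \<open>smul\<close> is
  multiplication by elements of \<open>'k\<close>.
\<close>

locale normed_space_over = vector_space smul
  for smul :: "'k::{real_normed_field, euclidean_space} \<Rightarrow> 'v::real_normed_vector \<Rightarrow> 'v" +
  assumes norm_smul: "norm (smul a x) = norm a * norm x"
    and smul_of_real: "smul (of_real r) x = r *\<^sub>R x"

definition continuous_dual ::
  "('k::{real_normed_field, euclidean_space} \<Rightarrow> 'v::real_normed_vector \<Rightarrow> 'v) \<Rightarrow> ('v \<Rightarrow>\<^sub>L 'k) set"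
  where "continuous_dual smul = {\<theta>. Vector_Spaces.linear smul (*) (blinfun_apply \<theta>)}"

locale bounded_op_representation = Group.group G + normed_space_over smul
  for G :: "('g, 'm) monoid_scheme" (structure)
    and smul :: "'k::{real_normed_field, euclidean_space} \<Rightarrow> 'v::real_normed_vector \<Rightarrow> 'v" +
  fixes \<pi> :: "'g \<Rightarrow> 'v \<Rightarrow> 'v"
  assumes rep_linear: "g \<in> carrier G \<Longrightarrow> Vector_Spaces.linear smul smul (\<pi> g)"
    and rep_bounded: "g \<in> carrier G \<Longrightarrow> bounded_linear (\<pi> g)"
    and rep_one: "\<pi> \<one> = id"
    and rep_mult: "g \<in> carrier G \<Longrightarrow> h \<in> carrier G \<Longrightarrow> \<pi> (g \<otimes> h) = \<pi> g \<circ> \<pi> h"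

text \<open>
  Operator norm of \<open>T : W \<rightarrow> W\<close> for the norm \<open>N\<close> on the subspace \<open>W\<close>. It is infinite exactly when
  \<open>T\<close> is unbounded for \<open>N\<close>, which is not excluded for an invariant subspace carrying its own norm.
\<close>

definition op_norm_on :: "'v set \<Rightarrow> ('v \<Rightarrow> real) \<Rightarrow> ('v \<Rightarrow> 'v) \<Rightarrow> ennreal"
  where "op_norm_on W N T = (SUP w \<in> {w \<in> W. N w \<le> 1}. ennreal (N (T w)))"

definition uniformly_bounded_on ::
  "('g, 'm) monoid_scheme \<Rightarrow> ('g \<Rightarrow> 'v \<Rightarrow> 'v) \<Rightarrow> 'v set \<Rightarrow> ('v \<Rightarrow> real) \<Rightarrow> bool"
  where "uniformly_bounded_on G \<pi> W N \<longleftrightarrow> (SUP g \<in> carrier G. op_norm_on W N (\<pi> g)) < \<infinity>"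

text \<open>
  The group element must be found for finitely many functionals simultaneously. Asking this only
  for one functional at a time is too weak: the rotations of the Euclidean plane (as a real
  space) satisfy that version, since every vector can be rotated into the kernel of a given
  functional, although they form an isometric representation on a finite-dimensional space.
\<close>

definition weakly_mixing ::
  "('g, 'm) monoid_scheme \<Rightarrow>
   ('k::{real_normed_field, euclidean_space} \<Rightarrow> 'v::real_normed_vector \<Rightarrow> 'v) \<Rightarrow>
   ('g \<Rightarrow> 'v \<Rightarrow> 'v) \<Rightarrow> bool"
  where "weakly_mixing G smul \<pi> \<longleftrightarrow>
    (\<forall>\<Theta> v. \<forall>\<epsilon>>0. finite \<Theta> \<and> \<Theta> \<subseteq> continuous_dual smul \<longrightarrow>
      (\<exists>g \<in> carrier G. \<forall>\<theta> \<in> \<Theta>. norm (blinfun_apply \<theta> (\<pi> g v)) < \<epsilon>))"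

definition norm_on ::
  "('k::real_normed_field \<Rightarrow> 'v::ab_group_add \<Rightarrow> 'v) \<Rightarrow> 'v set \<Rightarrow> ('v \<Rightarrow> real) \<Rightarrow> bool"
  where "norm_on smul W N \<longleftrightarrow>
    (\<forall>w\<in>W. 0 \<le> N w \<and> (N w = 0 \<longleftrightarrow> w = 0)) \<and>
    (\<forall>a. \<forall>w\<in>W. N (smul a w) = norm a * N w) \<and>
    (\<forall>w\<in>W. \<forall>w'\<in>W. N (w + w') \<le> N w + N w')"

definition compact_inclusion :: "'v::real_normed_vector set \<Rightarrow> ('v \<Rightarrow> real) \<Rightarrow> bool"
  where "compact_inclusion W N \<longleftrightarrow> compact (closure {w \<in> W. N w \<le> 1})"

end

theory Submission
  imports Defs
begin

text \<open>
  Were \<open>\<pi>\<close> uniformly bounded on \<open>W\<close>, the orbit of a small nonzero \<open>w \<in> W\<close> would stay in the unit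
  ball of \<open>N\<close>, so it would be relatively compact in the ambient Banach space. Weak mixing gives points
  of this orbit at which any finite set of functionals is simultaneously small. By the finite
  intersection property a single point of the compact orbit closure is then annihilated by all
  continuous functionals, and by Hahn--Banach this point is \<open>0\<close>
  (\<open>weakly_mixing_compact_orbit_closure\<close>). But the inverses \<open>\<pi> (g\<inverse>)\<close> are uniformly bounded in the
  ambient norm, which keeps the orbit of a nonzero vector at positive distance from \<open>0\<close>
  (\<open>orbit_bounded_away_from_zero\<close>).

  The Hahn--Banach theorem is proved for real sublinear functionals by finding a minimal one, which
  has to be linear; no partially defined functionals occur. The passage from real functionals to
  functionals linear over the scalar field \<open>'k\<close> uses that \<open>(a, b) \<mapsto> 1 \<bullet> (a * b)\<close> is a nondegenerate
  form on \<open>'k\<close>, so real and complex scalars are treated alike.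
\<close>

section \<open>Sublinear functionals and the Hahn--Banach theorem\<close>

definition sublinear :: "('v::real_vector \<Rightarrow> real) \<Rightarrow> bool"
  where "sublinear p \<longleftrightarrow>
    (\<forall>x y. p (x + y) \<le> p x + p y) \<and> (\<forall>r\<ge>0. \<forall>x. p (r *\<^sub>R x) = r * p x)"

lemma sublinear_add: "sublinear p \<Longrightarrow> p (x + y) \<le> p x + p y"
  by (simp add: sublinear_def)

lemma sublinear_scale: "sublinear p \<Longrightarrow> 0 \<le> r \<Longrightarrow> p (r *\<^sub>R x) = r * p x"
  by (simp add: sublinear_def)

lemma sublinear_zero: "sublinear p \<Longrightarrow> p 0 = 0"
  using sublinear_scale[of p 0 0] by simp

lemma sublinear_minus_le: "sublinear p \<Longrightarrow> - p (- x) \<le> p x"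
  using sublinear_add[of p x "- x"] sublinear_zero[of p] by simp

lemma sublinearI:
  assumes add: "\<And>x y. p (x + y) \<le> p x + p y"
    and zero: "p 0 = 0"
    and scale: "\<And>r x. r > 0 \<Longrightarrow> p (r *\<^sub>R x) \<le> r * p x"
  shows "sublinear p"
  unfolding sublinear_def
proof (intro conjI allI impI)
  fix r :: real and x :: 'a
  assume r: "0 \<le> r"
  show "p (r *\<^sub>R x) = r * p x"
  proof (cases "r = 0")
    case False
    with r have "0 < r" by simp
    have "p x \<le> (1 / r) * p (r *\<^sub>R x)"
      using scale[of "1 / r" "r *\<^sub>R x"] \<open>0 < r\<close> by simp
    then have "r * p x \<le> p (r *\<^sub>R x)"
      using \<open>0 < r\<close> by (simp add: field_simps)
    with scale[OF \<open>0 < r\<close>, of x] show ?thesis by simp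
  qed (simp add: zero)
qed (rule add)

text \<open>
  The index \<open>k\<close> may depend on the vectors. This lets the lemma serve both for chains of sublinear
  functionals and for families whose members are not sublinear one by one, as in \<open>tilt\<close> below.
\<close>

lemma sublinear_INF:
  fixes f :: "'i \<Rightarrow> 'v::real_vector \<Rightarrow> real"
  assumes ne: "I \<noteq> {}"
    and bdd: "\<And>x. bdd_below ((\<lambda>i. f i x) ` I)"
    and zero: "\<And>i. i \<in> I \<Longrightarrow> f i 0 = 0"
    and add: "\<And>i j x y. i \<in> I \<Longrightarrow> j \<in> I \<Longrightarrow> \<exists>k\<in>I. f k (x + y) \<le> f i x + f j y"
    and scale: "\<And>i r x. i \<in> I \<Longrightarrow> r > 0 \<Longrightarrow> \<exists>k\<in>I. f k (r *\<^sub>R x) \<le> r * f i x"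
  shows "sublinear (\<lambda>x. INF i\<in>I. f i x)"
proof (rule sublinearI)
  let ?q = "\<lambda>x. INF i\<in>I. f i x"
  have lower: "?q x \<le> f i x" if "i \<in> I" for i x
    using bdd that by (rule cINF_lower)
  show "?q 0 = 0"
    using ne zero by simp
  show "?q (x + y) \<le> ?q x + ?q y" for x y
  proof -
    have "?q (x + y) - f j y \<le> ?q x" if "j \<in> I" for j
    proof (rule cINF_greatest[OF ne])
      fix i assume "i \<in> I"
      with that obtain k where "k \<in> I" "f k (x + y) \<le> f i x + f j y"
        using add by blast
      with lower[of k "x + y"] show "?q (x + y) - f j y \<le> f i x"
        by linarith
    qed
    then have "?q (x + y) - ?q x \<le> ?q y"
      by (intro cINF_greatest[OF ne]) (smt (verit))
    then show ?thesis by simp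
  qed
  show "?q (r *\<^sub>R x) \<le> r * ?q x" if "r > 0" for r x
  proof -
    have "?q (r *\<^sub>R x) / r \<le> ?q x"
    proof (rule cINF_greatest[OF ne])
      fix i assume "i \<in> I"
      with scale[OF this that, of x] lower have "?q (r *\<^sub>R x) \<le> r * f i x"
        by (meson order_trans)
      with that show "?q (r *\<^sub>R x) / r \<le> f i x"
        by (simp add: field_simps)
    qed
    with that show ?thesis by (simp add: field_simps)
  qed
qed

text \<open>
  The largest sublinear functional below \<open>p\<close> whose value at \<open>- y\<close> is at most \<open>- p y\<close>: by
  subadditivity the difference \<open>p (x + t *\<^sub>R y) - t * p y\<close> decreases in \<open>t\<close>, and the infimum is its limit.
\<close>

definition tilt :: "('v::real_vector \<Rightarrow> real) \<Rightarrow> 'v \<Rightarrow> 'v \<Rightarrow> real"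
  where "tilt p y x = (INF t\<in>{0..}. p (x + t *\<^sub>R y) - t * p y)"

lemma tilt_lower_bound:
  assumes p: "sublinear p" and t: "0 \<le> t"
  shows "- p (- x) \<le> p (x + t *\<^sub>R y) - t * p y"
  using sublinear_add[OF p, of "x + t *\<^sub>R y" "- x"] sublinear_scale[OF p t, of y] by simp

lemma tilt_le:
  assumes p: "sublinear p" and t: "0 \<le> t"
  shows "tilt p y x \<le> p (x + t *\<^sub>R y) - t * p y"
  unfolding tilt_def
proof (rule cINF_lower)
  show "bdd_below ((\<lambda>t. p (x + t *\<^sub>R y) - t * p y) ` {0..})"
    using tilt_lower_bound[OF p] by (intro bdd_belowI2) auto
qed (use t in auto)

lemma tilt_le_self: "sublinear p \<Longrightarrow> tilt p y \<le> p"
  using tilt_le[of p 0 y] by (auto simp: le_fun_def)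

lemma tilt_minus_le: "sublinear p \<Longrightarrow> tilt p y (- y) \<le> - p y"
  using tilt_le[of p 1 y "- y"] by (simp add: sublinear_zero)

lemma sublinear_tilt:
  assumes p: "sublinear p"
  shows "sublinear (tilt p y)"
  unfolding tilt_def[abs_def]
proof (rule sublinear_INF)
  show "bdd_below ((\<lambda>t. p (x + t *\<^sub>R y) - t * p y) ` {0..})" for x
    using tilt_lower_bound[OF p] by (intro bdd_belowI2) auto
  show "p (0 + t *\<^sub>R y) - t * p y = 0" if "t \<in> {0..}" for t
    using that sublinear_scale[OF p] by simp
  show "\<exists>k\<in>{0..}. p (u + v + k *\<^sub>R y) - k * p y \<le>
      (p (u + s *\<^sub>R y) - s * p y) + (p (v + t *\<^sub>R y) - t * p y)"
    if "s \<in> {0..}" "t \<in> {0..}" for s t u v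
    using that sublinear_add[OF p, of "u + s *\<^sub>R y" "v + t *\<^sub>R y"]
    by (intro bexI[of _ "s + t"]) (auto simp: algebra_simps)
  show "\<exists>k\<in>{0..}. p (r *\<^sub>R x + k *\<^sub>R y) - k * p y \<le> r * (p (x + t *\<^sub>R y) - t * p y)"
    if "t \<in> {0..}" "0 < r" for t r x
    using that sublinear_scale[OF p, of r "x + t *\<^sub>R y"]
    by (intro bexI[of _ "r * t"]) (auto simp: algebra_simps)
qed auto

text \<open>
  Minimality forces \<open>tilt p y = p\<close> for each \<open>y\<close>. The term \<open>t = 1\<close> of the infimum then gives
  \<open>p x \<le> p (x + y) - p y\<close>, the reverse of subadditivity.
\<close>

lemma linear_if_minimal_sublinear:
  assumes p: "sublinear p"
    and minimal: "\<And>q. sublinear q \<Longrightarrow> q \<le> p \<Longrightarrow> q = p"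
  shows "linear p"
proof -
  have tilt: "tilt p y = p" for y
    using minimal sublinear_tilt[OF p] tilt_le_self[OF p] by blast
  have add: "p (x + y) = p x + p y" for x y
    using tilt_le[OF p, of 1 y x] sublinear_add[OF p, of x y] by (simp add: tilt)
  have minus: "p (- x) = - p x" for x
    using add[of x "- x"] sublinear_zero[OF p] by simp
  have "p (r *\<^sub>R x) = r * p x" for r x
  proof (cases "0 \<le> r")
    case False
    then show ?thesis
      using sublinear_scale[OF p, of "- r" x] minus[of "r *\<^sub>R x"] by simp
  qed (rule sublinear_scale[OF p])
  with add show ?thesis by (intro linearI) auto
qed

text \<open>
  Zorn's lemma: \<open>- p (- x)\<close> bounds all sublinear functionals below \<open>p\<close> from below at \<open>x\<close>, so the
  pointwise infimum of a chain is finite, and it is again sublinear because any two members of the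
  chain are comparable.
\<close>

lemma exists_minimal_sublinear:
  assumes p: "sublinear p"
  obtains m where "sublinear m" "m \<le> p" "\<And>q. sublinear q \<Longrightarrow> q \<le> m \<Longrightarrow> q = m"
proof -
  define A where "A = {q. sublinear q \<and> q \<le> p}"
  have "\<exists>m\<in>A. \<forall>q\<in>A. q \<le> m \<longrightarrow> q = m"
  proof (rule predicate_Zorn)
    show "partial_order_on A (relation_of (\<lambda>a b. b \<le> a) A)"
      by (rule partial_order_on_relation_ofI) auto
    fix C assume "C \<in> Chains (relation_of (\<lambda>a b. b \<le> a) A)"
    then have sub: "C \<subseteq> A" and chain: "\<And>a b. a \<in> C \<Longrightarrow> b \<in> C \<Longrightarrow> a \<le> b \<or> b \<le> a"
      unfolding Chains_def relation_of_def by blast+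
    show "\<exists>u\<in>A. \<forall>a\<in>C. u \<le> a"
    proof (cases "C = {}")
      case True
      then show ?thesis using p by (auto simp: A_def)
    next
      case False
      have C: "sublinear q" "q \<le> p" if "q \<in> C" for q
        using sub that by (auto simp: A_def)
      let ?u = "\<lambda>x. INF q\<in>C. q x"
      have "- p (- x) \<le> q x" if "q \<in> C" for q x
        using sublinear_minus_le[OF C(1)[OF that], of x] le_funD[OF C(2)[OF that], of "- x"]
        by simp
      then have bdd: "bdd_below ((\<lambda>q. q x) ` C)" for x
        by (rule bdd_belowI2)
      have lower: "?u \<le> q" if "q \<in> C" for q
        using bdd that by (auto simp: le_fun_def intro: cINF_lower)
      have "sublinear ?u"
      proof (rule sublinear_INF[OF False bdd])
        show "\<exists>k\<in>C. k (x + y) \<le> a x + b y" if ab: "a \<in> C" "b \<in> C" for a b x y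
          using chain[OF ab]
        proof
          assume "a \<le> b"
          then show ?thesis
            using sublinear_add[OF C(1)[OF ab(1)], of x y] ab(1) le_funD[of a b y]
            by (intro bexI[of _ a]) auto
        next
          assume "b \<le> a"
          then show ?thesis
            using sublinear_add[OF C(1)[OF ab(2)], of x y] ab(2) le_funD[of b a x]
            by (intro bexI[of _ b]) auto
        qed
        show "\<exists>k\<in>C. k (r *\<^sub>R x) \<le> r * a x" if "a \<in> C" "0 < r" for a r x
          using sublinear_scale[OF C(1)[OF that(1)], of r x] that by (intro bexI[of _ a]) auto
      qed (use C(1) sublinear_zero in blast)
      moreover obtain q where "q \<in> C" using False by blast
      ultimately have "?u \<in> A"
        using lower C(2) unfolding A_def by (blast intro: order_trans)
      with lower show ?thesis by blast
    qed
  qed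
  then show thesis
    using that unfolding A_def by (smt (verit) mem_Collect_eq order_trans)
qed

text \<open>
  A functional \<open>f \<le> tilt p y\<close> satisfies \<open>f (- y) \<le> - p y\<close>, which for linear \<open>f\<close> says
  \<open>p y \<le> f y\<close>. So every minimal sublinear functional below \<open>tilt p y\<close> is as required.
\<close>

theorem Hahn_Banach_sublinear:
  fixes p :: "'v::real_vector \<Rightarrow> real"
  assumes p: "sublinear p"
  obtains f where "linear f" "f \<le> p" "f y = p y"
proof -
  obtain m where m: "sublinear m" "m \<le> tilt p y"
    and min: "\<And>q. sublinear q \<Longrightarrow> q \<le> m \<Longrightarrow> q = m"
    using exists_minimal_sublinear[OF sublinear_tilt[OF p, of y]] by metis
  have lin: "linear m"
    using m(1) min by (rule linear_if_minimal_sublinear)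
  have le: "m \<le> p"
    using m(2) tilt_le_self[OF p] by (rule order_trans)
  have "m (- y) \<le> - p y"
    using le_funD[OF m(2)] tilt_minus_le[OF p] by (rule order_trans)
  then have "m y = p y"
    using le_funD[OF le, of y] linear_neg[OF lin, of y] by simp
  with lin le show thesis by (rule that)
qed

corollary exists_bounded_linear_functional:
  fixes y :: "'v::real_normed_vector"
  obtains f :: "'v \<Rightarrow> real" where "bounded_linear f" "f y = norm y"
proof -
  have "sublinear (norm :: 'v \<Rightarrow> real)"
    by (auto simp: sublinear_def norm_triangle_ineq)
  then obtain f where f: "linear f" "f \<le> norm" "f y = norm y"
    by (rule Hahn_Banach_sublinear)
  have "norm (f x) \<le> norm x * 1" for x
    using le_funD[OF f(2), of x] le_funD[OF f(2), of "- x"] linear_neg[OF f(1), of x] by simp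
  with f(1) have "bounded_linear f"
    by (intro bounded_linear.intro bounded_linear_axioms.intro) blast+
  with f(3) show thesis by (rule that[rotated -1])
qed

section \<open>Separation by scalar-linear functionals\<close>

text \<open>
  The real bilinear form \<open>(a, b) \<mapsto> 1 \<bullet> (a * b)\<close> represents every real functional \<open>a \<mapsto> c \<bullet> a\<close> on the
  scalar field. It is nondegenerate, since \<open>b \<noteq> 0\<close> pairs with its inverse to \<open>1 \<bullet> 1 = 1\<close>, and
  the field is finite-dimensional.
\<close>

lemma scalar_field_Riesz:
  obtains T :: "'k::{real_normed_field, euclidean_space} \<Rightarrow> 'k"
  where "linear T" "\<And>c a. inner 1 (a * T c) = inner c a"
proof -
  define L :: "'k \<Rightarrow> 'k" where "L b = (\<Sum>i\<in>Basis. inner 1 (i * b) *\<^sub>R i)" for b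
  have lin: "linear L"
    by (rule linearI)
      (simp_all add: L_def algebra_simps inner_add_right scaleR_sum_right sum.distrib)
  have inner_L: "inner (L b) a = inner 1 (a * b)" for a b
  proof -
    have "inner 1 (a * b) = inner 1 ((\<Sum>i\<in>Basis. inner a i *\<^sub>R i) * b)"
      by (simp add: euclidean_representation)
    also have "\<dots> = (\<Sum>i\<in>Basis. inner a i * inner 1 (i * b))"
      by (simp add: sum_distrib_right inner_sum_right)
    also have "\<dots> = inner a (L b)"
      by (simp add: L_def inner_sum_right mult.commute)
    finally show ?thesis by (simp add: inner_commute)
  qed
  have "b = 0" if "L b = 0" for b
  proof (rule ccontr)
    assume "b \<noteq> 0"
    then show False using inner_L[of b "inverse b"] that by simp
  qed
  then have inj: "inj L"
    using lin by (simp add: linear_injective_0)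
  then obtain T where T: "linear T" "\<And>c. L (T c) = c"
    using linear_injective_isomorphism[OF lin] by blast
  have "inner 1 (a * T c) = inner c a" for a c
    using inner_L[of "T c" a] T(2) by simp
  with T(1) show thesis by (rule that)
qed

lemma scalar_eqI:
  fixes b c :: "'k::{real_normed_field, euclidean_space}"
  assumes "\<And>a. inner 1 (a * b) = inner 1 (a * c)"
  shows "b = c"
proof (rule ccontr)
  assume "b \<noteq> c"
  then have "inverse (b - c) * (b - c) = 1" by simp
  moreover have "inner 1 (inverse (b - c) * (b - c)) = 0"
    using assms[of "inverse (b - c)"] by (simp add: right_diff_distrib inner_diff_right)
  ultimately show False by simp
qed

text \<open>
  Given a bounded real functional \<open>f\<close> with \<open>f x \<noteq> 0\<close>, let \<open>\<theta> v\<close> be the unique scalar with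
  \<open>1 \<bullet> (a * \<theta> v) = f (smul a v)\<close> for all \<open>a\<close>. Uniqueness makes \<open>\<theta>\<close> linear over the scalar field, and
  \<open>1 \<bullet> \<theta> x = f x\<close> is nonzero. For complex scalars this is the familiar
  \<open>\<theta> v = f v - \<i> f (\<i> v)\<close>.
\<close>

lemma (in normed_space_over) continuous_dual_separates_zero:
  assumes "x \<noteq> 0"
  obtains \<theta> where "\<theta> \<in> continuous_dual smul" "blinfun_apply \<theta> x \<noteq> 0"
proof -
  obtain f :: "'v \<Rightarrow> real" where f: "bounded_linear f" "f x = norm x"
    by (rule exists_bounded_linear_functional)
  obtain T :: "'k \<Rightarrow> 'k" where T: "linear T" "\<And>c a. inner 1 (a * T c) = inner c a"
    using scalar_field_Riesz by blast
  interpret f: bounded_linear f by (rule f(1))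
  have bl_smul: "bounded_linear (smul a)" for a
  proof
    show "smul a (u + v) = smul a u + smul a v" for u v
      by (rule scale_right_distrib)
    show "smul a (r *\<^sub>R u) = r *\<^sub>R smul a u" for r u
      by (metis smul_of_real scale_left_commute)
    show "\<exists>K. \<forall>u. norm (smul a u) \<le> norm u * K"
      by (auto simp: norm_smul mult.commute intro!: exI[of _ "norm a"])
  qed
  have smul_left_linear: "linear (\<lambda>a. smul a v)" for v
  proof (rule linearI)
    show "smul (r *\<^sub>R a) v = r *\<^sub>R smul a v" for r a
      by (metis scaleR_conv_of_real scale_scale smul_of_real)
  qed (rule scale_left_distrib)
  \<comment> \<open>\<open>c v\<close> is the gradient of the real functional \<open>a \<mapsto> f (smul a v)\<close>; then \<open>\<theta> v = T (c v)\<close>.\<close>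
  define c where "c v = (\<Sum>i\<in>Basis. f (smul i v) *\<^sub>R i)" for v
  have inner_c: "inner (c v) a = f (smul a v)" for v a
  proof -
    have lin: "linear (\<lambda>a. f (smul a v))"
      using linear_compose[OF smul_left_linear f.linear_axioms] by (simp add: o_def)
    have "f (smul a v) = f (smul (\<Sum>i\<in>Basis. inner a i *\<^sub>R i) v)"
      by (simp add: euclidean_representation)
    also have "\<dots> = (\<Sum>i\<in>Basis. inner a i * f (smul i v))"
      by (simp add: linear_sum[OF lin] linear_scale[OF lin])
    also have "\<dots> = inner a (c v)"
      by (simp add: c_def inner_sum_right mult.commute)
    finally show ?thesis by (simp add: inner_commute)
  qed
  have "bounded_linear c"
    unfolding c_def[abs_def]
    by (intro bounded_linear_sum bounded_linear_scaleR_const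
        bounded_linear_compose[OF f(1) bl_smul])
  then have bl: "bounded_linear (\<lambda>v. T (c v))"
    using T(1) by (intro bounded_linear_compose[of T c]) (simp_all add: linear_conv_bounded_linear)
  have repr: "inner 1 (a * T (c v)) = f (smul a v)" for a v
    by (simp add: T(2) inner_c)
  have "T (c (smul b v)) = b * T (c v)" for b v
  proof (rule scalar_eqI)
    fix a
    show "inner 1 (a * T (c (smul b v))) = inner 1 (a * (b * T (c v)))"
      using repr[of a "smul b v"] repr[of "a * b" v] by (simp add: mult.assoc)
  qed
  then have "Vector_Spaces.linear smul (*) (\<lambda>v. T (c v))"
    using linear_add[OF bounded_linear.linear[OF bl]]
    by (simp add: Vector_Spaces.linear_iff vector_space_axioms
        vector_space_over_itself.vector_space_axioms)
  then have "Blinfun (\<lambda>v. T (c v)) \<in> continuous_dual smul"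
    by (simp add: continuous_dual_def bounded_linear_Blinfun_apply[OF bl])
  moreover have "T (c x) \<noteq> 0"
    using repr[of 1 x] f(2) assms by auto
  then have "blinfun_apply (Blinfun (\<lambda>v. T (c v))) x \<noteq> 0"
    by (simp add: bounded_linear_Blinfun_apply[OF bl])
  ultimately show thesis by (rule that)
qed

section \<open>Orbits of uniformly bounded and of weakly mixing representations\<close>

context bounded_op_representation
begin

text \<open>
  Homogeneity extends the bound from the unit ball to all of \<open>W\<close>.
\<close>

lemma uniformly_bounded_onE:
  assumes W: "subspace W" and inv: "\<And>g. g \<in> carrier G \<Longrightarrow> \<pi> g ` W \<subseteq> W"
    and N: "norm_on smul W N" and bdd: "uniformly_bounded_on G \<pi> W N"
  obtains M where "0 < M" "\<And>g w. g \<in> carrier G \<Longrightarrow> w \<in> W \<Longrightarrow> N (\<pi> g w) \<le> M * N w"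
proof -
  define S where "S = (SUP g \<in> carrier G. op_norm_on W N (\<pi> g))"
  have S: "S < \<infinity>"
    using bdd by (simp add: uniformly_bounded_on_def S_def)
  have unit: "N (\<pi> g w) \<le> enn2real S" if g: "g \<in> carrier G" and w: "w \<in> W" "N w \<le> 1" for g w
  proof -
    have "ennreal (N (\<pi> g w)) \<le> op_norm_on W N (\<pi> g)"
      unfolding op_norm_on_def using w by (intro SUP_upper) auto
    also have "\<dots> \<le> S"
      unfolding S_def using g by (rule SUP_upper)
    also have "\<dots> = ennreal (enn2real S)"
      using S by simp
    finally show ?thesis by (simp add: ennreal_le_iff)
  qed
  show thesis
  \<comment> \<open>The summand \<open>1\<close> makes the constant positive, so that it can be divided by.\<close>
  proof (rule that[of "enn2real S + 1"])
    show "0 < enn2real S + 1"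
      using enn2real_nonneg[of S] by linarith
    fix g w assume g: "g \<in> carrier G" and w: "w \<in> W"
    interpret \<pi>g: Vector_Spaces.linear smul smul "\<pi> g" by (rule rep_linear[OF g])
    have nonneg: "0 \<le> N w" and Nzero: "N w = 0 \<longleftrightarrow> w = 0"
      and N_smul: "\<And>a u. u \<in> W \<Longrightarrow> N (smul a u) = norm a * N u"
      using N w by (auto simp: norm_on_def)
    have \<pi>w: "\<pi> g w \<in> W" using inv[OF g] w by blast
    show "N (\<pi> g w) \<le> (enn2real S + 1) * N w"
    proof (cases "w = 0")
      case True
      then show ?thesis using Nzero \<pi>g.zero by simp
    next
      case False
      then have pos: "0 < N w" using nonneg Nzero by simp
      define a :: 'k where "a = of_real (1 / N w)"
      have a: "norm a = 1 / N w" using pos by (simp add: a_def norm_divide)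
      have "N (\<pi> g (smul a w)) \<le> enn2real S"
        using unit[OF g subspace_scale[OF W w]] N_smul[OF w] a pos by simp
      then have "N (\<pi> g w) \<le> enn2real S * N w"
        using N_smul[OF \<pi>w] a pos by (simp add: \<pi>g.scale field_simps)
      then show ?thesis using pos by (simp add: algebra_simps)
    qed
  qed
qed

text \<open>
  If \<open>M\<close> bounds the operator norms, then \<open>w = \<pi> (g\<inverse>) (\<pi> g w)\<close> gives \<open>norm w \<le> M * norm (\<pi> g w)\<close>.
\<close>

lemma orbit_bounded_away_from_zero:
  assumes bdd: "uniformly_bounded_on G \<pi> UNIV norm" and "w \<noteq> 0"
  shows "0 \<notin> closure ((\<lambda>g. \<pi> g w) ` carrier G)"
proof -
  have "norm_on smul UNIV norm"
    by (auto simp: norm_on_def norm_smul norm_triangle_ineq)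
  then obtain M where M: "0 < M" "\<And>g v. g \<in> carrier G \<Longrightarrow> norm (\<pi> g v) \<le> M * norm v"
    using uniformly_bounded_onE[OF subspace_UNIV _ _ bdd] by auto
  have "norm w / M \<le> dist (\<pi> g w) 0" if g: "g \<in> carrier G" for g
  proof -
    have "\<pi> (inv g) (\<pi> g w) = w"
      using rep_mult[of "inv g" g] g rep_one by (metis comp_apply id_apply inv_closed l_inv)
    with M(2)[of "inv g" "\<pi> g w"] g have "norm w \<le> M * norm (\<pi> g w)"
      by simp
    with M(1) show ?thesis by (simp add: field_simps)
  qed
  moreover have "0 < norm w / M" using M(1) \<open>w \<noteq> 0\<close> by simp
  ultimately show ?thesis
    by (auto simp: closure_approachable not_less)
qed

text \<open>
  Weak mixing says that the closed sets \<open>{x. norm (\<theta> x) \<le> \<epsilon>}\<close>, over all continuous functionals \<open>\<theta>\<close>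
  and all \<open>\<epsilon> > 0\<close>, have the finite intersection property on the orbit. Compactness yields a point
  of the orbit closure in all of them; it is annihilated by every continuous functional, hence zero.
\<close>

lemma weakly_mixing_compact_orbit_closure:
  assumes mixing: "weakly_mixing G smul \<pi>"
    and compact: "compact (closure ((\<lambda>g. \<pi> g v) ` carrier G))"
  shows "0 \<in> closure ((\<lambda>g. \<pi> g v) ` carrier G)"
proof -
  let ?orbit = "(\<lambda>g. \<pi> g v) ` carrier G"
  define slab where "slab = (\<lambda>(\<theta> :: 'v \<Rightarrow>\<^sub>L 'k, \<epsilon> :: real). {x. norm (blinfun_apply \<theta> x) \<le> \<epsilon>})"
  let ?I = "continuous_dual smul \<times> {0<..}"
  have "closure ?orbit \<inter> \<Inter> (slab ` ?I) \<noteq> {}"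
  proof (rule compact_imp_fip[OF compact])
    fix T assume "T \<in> slab ` ?I"
    then show "closed T"
      by (auto simp: slab_def intro!: closed_Collect_le continuous_intros)
  next
    fix F assume "finite F" "F \<subseteq> slab ` ?I"
    then obtain J where J: "J \<subseteq> ?I" "finite J" "F = slab ` J"
      by (meson finite_subset_image)
    \<comment> \<open>The element \<open>1\<close> keeps the minimum defined when \<open>J\<close> is empty.\<close>
    define \<epsilon> where "\<epsilon> = Min (insert 1 (snd ` J))"
    have "0 < \<epsilon>" using J by (auto simp: \<epsilon>_def)
    then obtain g where g: "g \<in> carrier G" "\<And>\<theta>. \<theta> \<in> fst ` J \<Longrightarrow> norm (blinfun_apply \<theta> (\<pi> g v)) < \<epsilon>"
      using mixing[unfolded weakly_mixing_def, rule_format, of \<epsilon> "fst ` J" v] J by fastforce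
    have "\<pi> g v \<in> slab (\<theta>, \<delta>)" if "(\<theta>, \<delta>) \<in> J" for \<theta> \<delta>
    proof -
      have "\<epsilon> \<le> \<delta>"
        unfolding \<epsilon>_def using J(2) that by (intro Min_le) force+
      with g(2)[of \<theta>] that show ?thesis by (force simp: slab_def)
    qed
    then have "\<pi> g v \<in> closure ?orbit \<inter> \<Inter> F"
      using g(1) J(3) closure_subset[of ?orbit] by auto
    then show "closure ?orbit \<inter> \<Inter> F \<noteq> {}" by blast
  qed
  then obtain x where x: "x \<in> closure ?orbit"
    and small: "\<And>\<theta> \<epsilon>. \<theta> \<in> continuous_dual smul \<Longrightarrow> 0 < \<epsilon> \<Longrightarrow> norm (blinfun_apply \<theta> x) \<le> \<epsilon>"
    by (auto simp: slab_def)
  have "blinfun_apply \<theta> x = 0" if "\<theta> \<in> continuous_dual smul" for \<theta>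
    using field_le_epsilon[of "norm (blinfun_apply \<theta> x)" 0] small[OF that] by simp
  then have "x = 0"
    using continuous_dual_separates_zero by blast
  with x show ?thesis by simp
qed

end

theorem proposition1p2:
  fixes G :: "('g, 'm) monoid_scheme"
    and smul :: "'k::{real_normed_field, euclidean_space} \<Rightarrow> 'v::banach \<Rightarrow> 'v"
    and \<pi> :: "'g \<Rightarrow> 'v \<Rightarrow> 'v"
    and W :: "'v set"
    and N :: "'v \<Rightarrow> real"
  assumes "bounded_op_representation G smul \<pi>"
    and "weakly_mixing G smul \<pi>"
    and "uniformly_bounded_on G \<pi> UNIV norm"
    and "separable_space (top_of_set (continuous_dual smul))"
    and "module.subspace smul W"
    and "W \<noteq> {0}"
    and "\<And>g. g \<in> carrier G \<Longrightarrow> \<pi> g ` W \<subseteq> W"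
    and "norm_on smul W N"
    and "compact_inclusion W N"
  shows "\<not> uniformly_bounded_on G \<pi> W N"
proof
  assume bdd: "uniformly_bounded_on G \<pi> W N"
  interpret bounded_op_representation G smul \<pi> by fact
  obtain M where M: "0 < M" "\<And>g w. g \<in> carrier G \<Longrightarrow> w \<in> W \<Longrightarrow> N (\<pi> g w) \<le> M * N w"
    using uniformly_bounded_onE[OF assms(5,7,8) bdd] by blast
  obtain u where u: "u \<in> W" "u \<noteq> 0"
    using assms(6) subspace_0[OF assms(5)] by blast
  have Nu: "0 < N u" and N_smul: "\<And>a. N (smul a u) = norm a * N u"
    using assms(8) u by (auto simp: norm_on_def order_less_le)
  \<comment> \<open>Rescaled so that the whole orbit lies in the unit ball of \<open>N\<close>.\<close>
  define w where "w = smul (of_real (1 / (M * N u))) u"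
  have w: "w \<in> W" "w \<noteq> 0" "N w = 1 / M"
    using u Nu M(1) subspace_scale[OF assms(5)] N_smul
    by (auto simp: w_def norm_divide norm_mult)
  have "(\<lambda>g. \<pi> g w) ` carrier G \<subseteq> {w \<in> W. N w \<le> 1}"
    using M w assms(7) by fastforce
  then have "closure ((\<lambda>g. \<pi> g w) ` carrier G) \<subseteq> closure {w \<in> W. N w \<le> 1}"
    by (rule closure_mono)
  with assms(9) have "compact (closure ((\<lambda>g. \<pi> g w) ` carrier G))"
    unfolding compact_inclusion_def using closed_closure by (metis closed_Int_compact inf.absorb1)
  with assms(2) have "0 \<in> closure ((\<lambda>g. \<pi> g w) ` carrier G)"
    by (rule weakly_mixing_compact_orbit_closure)
  with orbit_bounded_away_from_zero[OF assms(3) w(2)] show False by blast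
qed

end
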